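(* For any integer $n\geq 3$, the map $d_s\colon(\mathbb{R}^2)^n\to[0,+\infty[$ that associates with any $(x_1,\ldots,x_n)\in(\mathbb{R}^2)^n$ the surface area bounded by $S(x_1,\ldots,x_n)$ is an $n$-distance on $\mathbb{R}^2$ whose best constant is $K_n^*=\big(n-\frac32\big)^{-1}$.
   Context: $S(x_1,\ldots,x_n)$ denotes the smallest circle (for the Euclidean distance, possibly of radius $0$) enclosing the points $x_1,\ldots,x_n\in\mathbb{R}^2$, i.e. the boundary of the unique closed disk of minimal radius containing $\{x_1,\ldots,x_n\}$; it exists and is unique. For a function $f\colon X^n\to[0,+\infty[$, $f(x_1,\ldots,x_n)_i^z$ denotes the value of $f$ at $(x_1,\ldots,x_{i-1},z,x_{i+1},\ldots,x_n)$. An $n$-distance on a nonempty set $X$ is a function $f\colon X^n\to[0,+\infty[$ such that: (i) $f(x_1,\ldots,x_n)\leq\sum_{i=1}^n f(x_1,\ldots,x_n)_i^z$ for all $x_1,\ldots,x_n,z\in X$; (ii) $f$ is invariant under all permutations of its arguments; (iii) $f(x_1,\ldots,x_n)=0$ if and only if $x_1=\cdots=x_n$. The best constant $K_n^*$ associated with an $n$-distance $f$ is the infimum of the set of real numbers $K\in\,]0,1]$ such that $f(x_1,\ldots,x_n)\leq K\sum_{i=1}^n f(x_1,\ldots,x_n)_i^z$ for all $x_1,\ldots,x_n,z\in X$. *)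

theory Defs
  imports "HOL-Analysis.Analysis" "HOL-Combinatorics.Permutations"
begin

text \<open>
  Elements of \<open>X\<^sup>n\<close> are lists of length \<open>n\<close> over \<open>X\<close>, with positions \<open>0, \<dots>, n - 1\<close>;
  \<open>f(x\<^sub>1, \<dots>, x\<^sub>n)\<^sub>i\<^sup>z\<close> is \<open>f (xs[i := z])\<close>. A function on \<open>X\<^sup>n\<close> is a function on
  lists of which only the values on \<open>tuples n X\<close> matter.
\<close>

definition tuples :: "nat \<Rightarrow> 'a set \<Rightarrow> 'a list set" where
  "tuples n X = {xs. length xs = n \<and> set xs \<subseteq> X}"

definition n_distance :: "nat \<Rightarrow> 'a set \<Rightarrow> ('a list \<Rightarrow> real) \<Rightarrow> bool" where
  "n_distance n X f \<longleftrightarrow>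
     X \<noteq> {} \<and>
     (\<forall>xs \<in> tuples n X. 0 \<le> f xs) \<and>
     (\<forall>xs \<in> tuples n X. \<forall>z \<in> X. f xs \<le> (\<Sum>i<n. f (xs[i := z]))) \<and>
     (\<forall>xs \<in> tuples n X. \<forall>p. p permutes {..<n} \<longrightarrow> f (permute_list p xs) = f xs) \<and>
     (\<forall>xs \<in> tuples n X. f xs = 0 \<longleftrightarrow> (\<forall>i<n. \<forall>j<n. xs ! i = xs ! j))"

definition best_constant :: "nat \<Rightarrow> 'a set \<Rightarrow> ('a list \<Rightarrow> real) \<Rightarrow> real" where
  "best_constant n X f =
     Inf {K. 0 < K \<and> K \<le> 1 \<and>
             (\<forall>xs \<in> tuples n X. \<forall>z \<in> X. f xs \<le> K * (\<Sum>i<n. f (xs[i := z])))}"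

definition is_smallest_enclosing_disk :: "(real^2) set \<Rightarrow> (real^2) set \<Rightarrow> bool" where
  "is_smallest_enclosing_disk A D \<longleftrightarrow>
     (\<exists>c r. 0 \<le> r \<and> D = cball c r \<and> A \<subseteq> D \<and>
            (\<forall>c' r'. 0 \<le> r' \<and> A \<subseteq> cball c' r' \<longrightarrow> r \<le> r'))"

definition smallest_enclosing_circle :: "(real^2) list \<Rightarrow> (real^2) set" where
  "smallest_enclosing_circle xs = frontier (THE D. is_smallest_enclosing_disk (set xs) D)"

text \<open>
  The region bounded by a circle \<open>S\<close> is \<open>inside S\<close>, the union of the bounded components of
  the complement of \<open>S\<close>; it is the open disk, which is empty for a circle of radius \<open>0\<close>.
\<close>

definition enclosing_area :: "(real^2) list \<Rightarrow> real" where
  "enclosing_area xs = measure lebesgue (inside (smallest_enclosing_circle xs))"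

end

theory Submission
  imports Defs
begin

text \<open>
  Let \<open>c\<close> and \<open>r\<close> be the centre and radius of the smallest disk enclosing the points
  \<open>x\<^sub>i\<close>. What makes a disk smallest is that its centre lies in the convex hull of those
  points that lie on its boundary (\<open>balanced_disk\<close>): a centre outside this hull could be moved towards
  all boundary points at once, and a centre inside it cannot be moved without receding
  from one of them.

  By Caratheodory's theorem in the plane, at most three of the boundary points, the support,
  already contain \<open>c\<close> in their hull, and they alone force the radius \<open>r\<close>
  (\<open>balanced_disk_support\<close>). If \<open>r > 0\<close> there are two or three of them. Replacing a point outside
  the support by \<open>z\<close> leaves an area of at least \<open>\<pi> r\<^sup>2\<close>. Replacing a support point is controlled by
  the fact that a disk containing \<open>a\<close> and \<open>b\<close> has area at least \<open>\<pi> |a - b|\<^sup>2 / 4\<close>.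

  \<^item> If the support is a pair \<open>a, b\<close>, then \<open>|a - b| = 2 r\<close>, and the two replacements contribute at
    least \<open>\<pi> (|a - z|\<^sup>2 + |b - z|\<^sup>2) / 4 \<ge> \<pi> r\<^sup>2 / 2\<close>. The total is at least
    \<open>(n - 2 + 1/2) \<pi> r\<^sup>2\<close>.

  \<^item> If the support is a triple, it is a non-obtuse triangle with circumradius \<open>r\<close>, and the squares
    of its sides add up to at least \<open>8 r\<^sup>2\<close> (\<open>sum_sq_sides_ge\<close>), so that the three replacements
    contribute at least \<open>2 \<pi> r\<^sup>2\<close> whatever \<open>z\<close> is. The total is at least
    \<open>(n - 1) \<pi> r\<^sup>2\<close>.

  The pair case is the worse one, and it is attained by two antipodal points together with \<open>n - 2\<close>
  copies of their midpoint, where \<open>z\<close> is the midpoint too.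
\<close>

section \<open>Disks whose centre is balanced by their boundary points\<close>

definition balanced_disk :: "'a::euclidean_space set \<Rightarrow> 'a \<Rightarrow> real \<Rightarrow> bool" where
  "balanced_disk A c r \<longleftrightarrow> 0 \<le> r \<and> A \<subseteq> cball c r \<and> c \<in> convex hull (A \<inter> sphere c r)"

lemma dist_sq_shift:
  fixes a c d :: "'a::euclidean_space"
  shows "(dist a d)\<^sup>2 = (dist a c)\<^sup>2 - 2 * ((a - c) \<bullet> (d - c)) + (dist c d)\<^sup>2"
  unfolding dist_norm power2_norm_eq_inner
  by (simp add: inner_diff_left inner_diff_right inner_commute algebra_simps)

text \<open>
  If \<open>c\<close> is in the hull of points of the sphere, these points cannot all lie strictly on the side
  of \<open>c\<close> that faces \<open>d\<close>. By the law of cosines, a point on the other side is far from \<open>d\<close>.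
\<close>

lemma hull_sphere_far_point:
  fixes c d :: "'a::euclidean_space"
  assumes "T \<subseteq> sphere c r" "c \<in> convex hull T"
  obtains a where "a \<in> T" "r\<^sup>2 + (dist c d)\<^sup>2 \<le> (dist a d)\<^sup>2"
proof -
  have "\<exists>a\<in>T. (a - c) \<bullet> (d - c) \<le> 0"
  proof (rule ccontr)
    assume "\<not> ?thesis"
    then have "T \<subseteq> {x. (d - c) \<bullet> x > (d - c) \<bullet> c}"
      by (auto simp: inner_diff_left inner_diff_right inner_commute algebra_simps not_le)
    then have "convex hull T \<subseteq> {x. (d - c) \<bullet> x > (d - c) \<bullet> c}"
      by (intro hull_minimal convex_halfspace_gt)
    with assms(2) show False by auto
  qed
  then obtain a where "a \<in> T" "(a - c) \<bullet> (d - c) \<le> 0" by blast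
  moreover have "dist a c = r" using \<open>a \<in> T\<close> assms(1) by (auto simp: dist_commute)
  ultimately show ?thesis
    using dist_sq_shift[of a d c] by (intro that) auto
qed

text \<open>
  This single inequality gives minimality of the radius, and, when \<open>s = r\<close>, uniqueness of the
  centre.
\<close>

lemma balanced_disk_least:
  assumes "balanced_disk A c r" "A \<subseteq> cball d s" "0 \<le> s"
  shows "r\<^sup>2 + (dist c d)\<^sup>2 \<le> s\<^sup>2"
proof -
  obtain a where a: "a \<in> A \<inter> sphere c r" "r\<^sup>2 + (dist c d)\<^sup>2 \<le> (dist a d)\<^sup>2"
    using hull_sphere_far_point[of "A \<inter> sphere c r" c r d] assms(1)
    unfolding balanced_disk_def by auto
  have "dist a d \<le> s" using a(1) assms(2) by (auto simp: dist_commute)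
  then have "(dist a d)\<^sup>2 \<le> s\<^sup>2" by (intro power_mono) auto
  with a(2) show ?thesis by linarith
qed

lemma balanced_disk_subset:
  assumes "balanced_disk A c r" "S \<subseteq> A" "S \<subseteq> sphere c r" "c \<in> convex hull S"
  shows "balanced_disk S c r"
  using assms unfolding balanced_disk_def by (auto simp: Int_absorb2)

text \<open>
  The centre is a minimiser of the largest distance \<open>g\<close> to a point of \<open>A\<close>. If it were not in the
  hull of the points at distance exactly \<open>g c\<close>, a hyperplane would separate it from them, and a
  small step in the normal direction would bring it closer to all these points while keeping the
  other points at distance less than \<open>g c\<close>, so \<open>g\<close> would decrease.
\<close>

lemma balanced_disk_exists:
  fixes A :: "'a::euclidean_space set"
  assumes "finite A" "A \<noteq> {}"
  obtains c r where "balanced_disk A c r"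
proof -
  define g where "g c = Max ((\<lambda>a. dist a c) ` A)" for c
  have g_le: "g c \<le> t \<longleftrightarrow> (\<forall>a\<in>A. dist a c \<le> t)"
    and g_less: "g c < t \<longleftrightarrow> (\<forall>a\<in>A. dist a c < t)" for c t
    using assms by (auto simp: g_def)
  have g_ge: "dist a c \<le> g c" if "a \<in> A" for a c
    using g_le[of c "g c"] that by auto
  have g_lip: "g c \<le> g d + dist c d" for c d
    unfolding g_le using g_ge[of _ d] dist_triangle[of _ c d]
    by (smt (verit) dist_commute)
  have cont: "continuous_on UNIV g"
  proof (rule continuous_onI)
    fix x e assume "(e::real) > 0"
    moreover have "dist (g y) (g x) \<le> dist y x" for y
      using g_lip[of x y] g_lip[of y x] by (auto simp: dist_real_def dist_commute)
    ultimately show "\<exists>d>0. \<forall>y\<in>UNIV. dist y x < d \<longrightarrow> dist (g y) (g x) \<le> e"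
      by (meson less_imp_le order_trans)
  qed
  obtain a0 where a0: "a0 \<in> A" using assms by blast
  have "compact (cball a0 (g a0))" "cball a0 (g a0) \<noteq> {}"
    using g_ge[OF a0, of a0] by auto
  then obtain c where c: "c \<in> cball a0 (g a0)" "\<forall>d\<in>cball a0 (g a0). g c \<le> g d"
    using continuous_attains_inf[of "cball a0 (g a0)" g] cont continuous_on_subset by blast
  \<comment> \<open>Outside \<open>cball a0 (g a0)\<close> the value of \<open>g\<close> already exceeds \<open>g a0\<close>, so the minimum over the ball is a global one.\<close>
  have min: "g c \<le> g d" for d
  proof (cases "d \<in> cball a0 (g a0)")
    case False
    then have "g a0 < g d" using g_ge[OF a0, of d] by auto
    moreover have "g c \<le> g a0" using c(2) g_ge[OF a0, of a0] by auto
    ultimately show ?thesis by simp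
  qed (use c in auto)
  define T where "T = A \<inter> sphere c (g c)"
  have "c \<in> convex hull T"
  proof (rule ccontr)
    assume "c \<notin> convex hull T"
    moreover have "closed (convex hull T)"
      using assms(1) by (intro compact_imp_closed finite_imp_compact_convex_hull) (auto simp: T_def)
    ultimately obtain v b where v: "v \<bullet> c < b" "\<forall>x\<in>convex hull T. v \<bullet> x > b"
      using separating_hyperplane_closed_point[of "convex hull T" c] by auto
    have "\<forall>\<^sub>F t in at_right 0. dist a (c + t *\<^sub>R v) < g c" if "a \<in> A" for a
    proof (cases "a \<in> T")
      case True
      then have "v \<bullet> a > b" using v(2) by (simp add: hull_inc)
      then have pos: "(a - c) \<bullet> v > 0" using v(1)
        by (simp add: inner_diff_left inner_diff_right inner_commute)
      have "((\<lambda>t. t * (norm v)\<^sup>2) \<longlongrightarrow> 0 * (norm v)\<^sup>2) (at_right 0)" by (intro tendsto_intros)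
      then have "\<forall>\<^sub>F t in at_right 0. t * (norm v)\<^sup>2 < 2 * ((a - c) \<bullet> v)"
        using pos by (intro order_tendstoD(2)[where y="0 * (norm v)\<^sup>2"]) auto
      moreover have "\<forall>\<^sub>F t in at_right 0. (t::real) > 0" by (simp add: eventually_at_right_less)
      ultimately show ?thesis
      proof eventually_elim
        case (elim t)
        have "dist a c = g c" using True by (auto simp: T_def dist_commute)
        then have "(dist a (c + t *\<^sub>R v))\<^sup>2 = (g c)\<^sup>2 - t * (2 * ((a - c) \<bullet> v) - t * (norm v)\<^sup>2)"
          using dist_sq_shift[of a "c + t *\<^sub>R v" c]
          by (simp add: dist_norm power_mult_distrib power2_eq_square algebra_simps)
        moreover have "t * (2 * ((a - c) \<bullet> v) - t * (norm v)\<^sup>2) > 0" using elim by simp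
        ultimately have "(dist a (c + t *\<^sub>R v))\<^sup>2 < (g c)\<^sup>2" by linarith
        moreover have "0 \<le> g c" using \<open>dist a c = g c\<close> zero_le_dist by metis
        ultimately show ?case by (rule power2_less_imp_less)
      qed
    next
      case False
      then have "dist a (c + 0 *\<^sub>R v) < g c"
        using g_ge[OF that, of c] that by (auto simp: T_def dist_commute)
      moreover have "((\<lambda>t. dist a (c + t *\<^sub>R v)) \<longlongrightarrow> dist a (c + 0 *\<^sub>R v)) (at_right 0)"
        by (intro tendsto_intros)
      ultimately show ?thesis by (metis order_tendstoD(2))
    qed
    then have "\<forall>\<^sub>F t in at_right 0. g (c + t *\<^sub>R v) < g c"
      unfolding g_less using assms(1) by (intro eventually_ball_finite) auto
    then have "\<exists>t. g (c + t *\<^sub>R v) < g c"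
      using eventually_happens' trivial_limit_at_right_real by blast
    with min show False by (meson not_le)
  qed
  moreover have "A \<subseteq> cball c (g c)" using g_ge by (auto simp: dist_commute)
  moreover have "0 \<le> g c" using g_ge[OF a0, of c] zero_le_dist[of a0 c] by linarith
  ultimately show ?thesis using that by (auto simp: balanced_disk_def T_def)
qed

section \<open>The enclosed area\<close>

lemma balanced_disk_is_smallest:
  fixes A :: "(real^2) set"
  assumes "balanced_disk A c r"
  shows "is_smallest_enclosing_disk A D \<longleftrightarrow> D = cball c r"
proof
  have r: "0 \<le> r" "A \<subseteq> cball c r" using assms by (auto simp: balanced_disk_def)
  have least: "r \<le> s" if "0 \<le> s" "A \<subseteq> cball d s" for d s
  proof -
    have "r\<^sup>2 \<le> s\<^sup>2" using balanced_disk_least[OF assms that(2,1)] zero_le_power2[of "dist c d"]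
      by linarith
    then show ?thesis using that(1) by (rule power2_le_imp_le)
  qed
  show "is_smallest_enclosing_disk A D" if "D = cball c r"
    unfolding is_smallest_enclosing_disk_def
  proof (intro exI conjI allI impI)
    show "r \<le> s" if "0 \<le> s \<and> A \<subseteq> cball d s" for d s
      using least that by blast
  qed (use that r in auto)
  assume "is_smallest_enclosing_disk A D"
  then obtain d s where ds: "0 \<le> s" "D = cball d s" "A \<subseteq> cball d s" "s \<le> r"
    using r unfolding is_smallest_enclosing_disk_def by auto
  then have "s = r" using least[of s d] by auto
  then have "dist c d = 0" using balanced_disk_least[OF assms ds(3,1)] by auto
  with ds \<open>s = r\<close> show "D = cball c r" by simp
qed

text \<open>
  The inside of the boundary of a disk is its interior, the open disk. This includes radius
  \<open>0\<close>, where both are empty.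
\<close>

lemma enclosing_area_eq:
  assumes "balanced_disk (set xs) c r"
  shows "enclosing_area xs = pi * r\<^sup>2"
proof -
  have "r \<ge> 0" using assms by (auto simp: balanced_disk_def)
  have "smallest_enclosing_circle xs = frontier (cball c r)"
    unfolding smallest_enclosing_circle_def balanced_disk_is_smallest[OF assms] by simp
  also have "inside \<dots> = interior (cball c r)"
    by (rule inside_frontier_eq_interior) auto
  finally show ?thesis
    using \<open>r \<ge> 0\<close> content_ball[of r c] by (simp add: enclosing_area_def measure_completion unit_ball_vol_2)
qed

lemma enclosing_area_disk:
  assumes "xs \<noteq> []"
  obtains c r where "balanced_disk (set xs) c r" "enclosing_area xs = pi * r\<^sup>2"
  using balanced_disk_exists[of "set xs"] assms enclosing_area_eq by (metis List.finite_set set_empty)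

lemma enclosing_area_nonneg: "0 \<le> enclosing_area xs"
  by (simp add: enclosing_area_def)

lemma enclosing_area_le:
  assumes "xs \<noteq> []" "set xs \<subseteq> cball d s" "0 \<le> s"
  shows "enclosing_area xs \<le> pi * s\<^sup>2"
proof -
  obtain c r where cr: "balanced_disk (set xs) c r" "enclosing_area xs = pi * r\<^sup>2"
    using enclosing_area_disk[OF assms(1)] .
  have "r\<^sup>2 \<le> s\<^sup>2" using balanced_disk_least[OF cr(1) assms(2,3)] zero_le_power2[of "dist c d"] by linarith
  then show ?thesis using cr(2) by simp
qed

lemma enclosing_area_ge_balanced:
  assumes "balanced_disk S c r" "S \<subseteq> set ys" "ys \<noteq> []"
  shows "pi * r\<^sup>2 \<le> enclosing_area ys"
proof -
  obtain d s where ds: "balanced_disk (set ys) d s" "enclosing_area ys = pi * s\<^sup>2"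
    using enclosing_area_disk[OF assms(3)] .
  then have "S \<subseteq> cball d s" "0 \<le> s" using assms(2) by (auto simp: balanced_disk_def)
  then have "r\<^sup>2 \<le> s\<^sup>2" using balanced_disk_least[OF assms(1)] zero_le_power2[of "dist c d"]
    by (smt (verit))
  then show ?thesis using ds(2) by simp
qed

lemma balanced_disk_pair:
  fixes a b :: "'a::euclidean_space"
  shows "balanced_disk {a, b} (midpoint a b) (dist a b / 2)"
proof -
  have "{a, b} \<subseteq> sphere (midpoint a b) (dist a b / 2)" by (auto simp: dist_midpoint)
  moreover have "midpoint a b \<in> convex hull {a, b}"
    by (simp add: segment_convex_hull[symmetric])
  ultimately show ?thesis by (auto simp: balanced_disk_def Int_absorb2 dist_midpoint)
qed

lemma enclosing_area_ge_pair:
  assumes "a \<in> set ys" "b \<in> set ys"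
  shows "pi * (dist a b)\<^sup>2 / 4 \<le> enclosing_area ys"
proof -
  have "{a, b} \<subseteq> set ys" "ys \<noteq> []" using assms by auto
  from enclosing_area_ge_balanced[OF balanced_disk_pair this] show ?thesis
    by (simp add: power_divide)
qed

lemma enclosing_area_eq_0_iff:
  assumes "xs \<noteq> []"
  shows "enclosing_area xs = 0 \<longleftrightarrow> (\<forall>a\<in>set xs. \<forall>b\<in>set xs. a = b)"
proof
  assume 0: "enclosing_area xs = 0"
  show "\<forall>a\<in>set xs. \<forall>b\<in>set xs. a = b"
  proof (intro ballI)
    fix a b assume "a \<in> set xs" "b \<in> set xs"
    from enclosing_area_ge_pair[OF this] have "pi * (dist a b)\<^sup>2 \<le> 0" using 0 by simp
    then have "\<not> 0 < (dist a b)\<^sup>2" using mult_pos_pos[OF pi_gt_zero, of "(dist a b)\<^sup>2"] by linarith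
    then show "a = b" by simp
  qed
next
  assume "\<forall>a\<in>set xs. \<forall>b\<in>set xs. a = b"
  then have "set xs \<subseteq> {hd xs}" using hd_in_set[OF assms] by blast
  then have "set xs \<subseteq> cball (hd xs) 0" by simp
  from enclosing_area_le[OF assms this] have "enclosing_area xs \<le> 0" by simp
  with enclosing_area_nonneg[of xs] show "enclosing_area xs = 0" by linarith
qed

section \<open>The support of the smallest enclosing disk\<close>

text \<open>
  If \<open>x, y, z\<close> are the vertices of a triangle, its circumcentre is \<open>0\<close> and its orthocentre is
  \<open>x + y + z\<close>, so the claim is that the orthocentre stays in the circumscribed disk. Solving the relation for the vector of largest
  weight gives \<open>z = - s x - t y\<close> with \<open>s, t \<le> 1\<close>. Then \<open>r = |z| \<le> (s + t) r\<close>, whereas the sum is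
  \<open>(1 - s) x + (1 - t) y\<close>, of norm at most \<open>(2 - s - t) r\<close>.
\<close>

lemma norm_sum_balanced_triple_le:
  fixes x y z :: "'a::euclidean_space"
  assumes n: "norm x = r" "norm y = r" "norm z = r"
    and c: "u *\<^sub>R x + v *\<^sub>R y + w *\<^sub>R z = 0" "0 \<le> u" "0 \<le> v" "u \<le> w" "v \<le> w" "0 < w"
  shows "norm (x + y + z) \<le> r"
proof -
  define s t where "s = u / w" "t = v / w"
  have st: "0 \<le> s" "s \<le> 1" "0 \<le> t" "t \<le> 1" using c by (auto simp: s_t_def)
  have "w *\<^sub>R (s *\<^sub>R x + t *\<^sub>R y + z) = 0" using c by (simp add: s_t_def algebra_simps)
  then have "s *\<^sub>R x + t *\<^sub>R y + z = 0" using c by simp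
  then have z: "z = - (s *\<^sub>R x + t *\<^sub>R y)" using eq_neg_iff_add_eq_0 add.commute by metis
  have "r \<le> s * r + t * r"
    using norm_triangle_ineq[of "s *\<^sub>R x" "t *\<^sub>R y"] n st
      norm_minus_cancel[of "s *\<^sub>R x + t *\<^sub>R y", folded z] by simp
  moreover have "x + y + z = (1 - s) *\<^sub>R x + (1 - t) *\<^sub>R y" using z by (simp add: algebra_simps)
  then have "norm (x + y + z) \<le> (1 - s) * r + (1 - t) * r"
    using norm_triangle_ineq[of "(1 - s) *\<^sub>R x" "(1 - t) *\<^sub>R y"] n st by simp
  ultimately show ?thesis by (simp add: algebra_simps)
qed

text \<open>
  With the circumcentre as origin, the squared sides and the squared norm of the orthocentre
  add up to \<open>9 r\<^sup>2\<close>, and the orthocentre has norm at most \<open>r\<close>. A right triangle attains equality.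
\<close>

lemma sum_sq_sides_ge:
  fixes a b c p :: "'a::euclidean_space"
  assumes "{a, b, c} \<subseteq> sphere p r" "p \<in> convex hull {a, b, c}"
  shows "8 * r\<^sup>2 \<le> (dist a b)\<^sup>2 + (dist b c)\<^sup>2 + (dist c a)\<^sup>2"
proof -
  define x y z where "x = a - p" "y = b - p" "z = c - p"
  note d = x_y_z_def
  have n: "norm x = r" "norm y = r" "norm z = r"
    using assms(1) by (auto simp: d dist_norm norm_minus_commute)
  obtain u v w where uvw: "0 \<le> u" "0 \<le> v" "0 \<le> w" "u + v + w = 1" "p = u *\<^sub>R a + v *\<^sub>R b + w *\<^sub>R c"
    using assms(2) unfolding convex_hull_3 by auto
  have "u *\<^sub>R x + v *\<^sub>R y + w *\<^sub>R z = p - (u + v + w) *\<^sub>R p"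
    using uvw(5) by (simp add: d algebra_simps)
  then have 0: "u *\<^sub>R x + v *\<^sub>R y + w *\<^sub>R z = 0" by (simp add: uvw(4))
  \<comment> \<open>The three vectors are permuted so that the one of largest weight comes last.\<close>
  have "norm (x + y + z) \<le> r"
  proof -
    consider "u \<le> w" "v \<le> w" | "u \<le> v" "w \<le> v" | "v \<le> u" "w \<le> u" by linarith
    then show ?thesis
    proof cases
      case 1 then show ?thesis using norm_sum_balanced_triple_le[OF n 0] uvw by auto
    next
      case 2 then show ?thesis
        using norm_sum_balanced_triple_le[of x r z y u w v] n 0 uvw by (auto simp: add_ac)
    next
      case 3 then show ?thesis
        using norm_sum_balanced_triple_le[of y r z x v w u] n 0 uvw by (auto simp: add_ac)
    qed
  qed
  then have "(norm (x + y + z))\<^sup>2 \<le> r\<^sup>2" by (intro power_mono) auto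
  moreover have "(norm (x + y + z))\<^sup>2 + (norm (x - y))\<^sup>2 + (norm (y - z))\<^sup>2 + (norm (z - x))\<^sup>2
      = 3 * ((norm x)\<^sup>2 + (norm y)\<^sup>2 + (norm z)\<^sup>2)"
    unfolding power2_norm_eq_inner
    by (simp add: inner_diff_left inner_diff_right inner_add_left inner_add_right inner_commute algebra_simps)
  moreover have "x - y = a - b" "y - z = b - c" "z - x = c - a" by (auto simp: d)
  ultimately show ?thesis using n by (simp add: dist_norm)
qed

text \<open>
  A support of one point is excluded because it would be the centre itself, at distance
  \<open>0 < r\<close> from the centre.
\<close>

lemma balanced_disk_support:
  fixes A :: "(real^2) set"
  assumes "balanced_disk A c r" "0 < r"
  obtains (pair) a b where "a \<noteq> b" "{a, b} \<subseteq> A" "balanced_disk {a, b} c r" "dist a b = 2 * r"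
  | (triple) a b d where "distinct [a, b, d]" "{a, b, d} \<subseteq> A" "balanced_disk {a, b, d} c r"
      "8 * r\<^sup>2 \<le> (dist a b)\<^sup>2 + (dist b d)\<^sup>2 + (dist d a)\<^sup>2"
proof -
  have "c \<in> convex hull (A \<inter> sphere c r)" using assms by (simp add: balanced_disk_def)
  then obtain S where S: "finite S" "S \<subseteq> A \<inter> sphere c r" "card S \<le> 3" "c \<in> convex hull S"
    unfolding caratheodory[of "A \<inter> sphere c r"] by auto
  have bal: "balanced_disk S c r" using balanced_disk_subset[OF assms(1)] S by auto
  have "card S \<noteq> 0" using S by auto
  moreover have "card S \<noteq> 1"
    using S assms(2) by (auto simp: card_1_singleton_iff)
  ultimately have "card S = 2 \<or> card S = 3" using S(3) by linarith
  then show ?thesis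
  proof
    assume "card S = 2"
    then obtain a b where ab: "S = {a, b}" "a \<noteq> b" by (meson card_2_iff)
    have "c \<in> closed_segment a b" using S(4) ab by (simp add: segment_convex_hull)
    then have "dist a b = dist a c + dist c b" by (simp add: between_mem_segment[symmetric] between)
    also have "\<dots> = 2 * r" using S(2) ab by (auto simp: dist_commute)
    finally show ?thesis using pair ab S bal by auto
  next
    assume "card S = 3"
    then obtain a b d where abd: "S = {a, b, d}" "distinct [a, b, d]"
      unfolding card_3_iff by auto
    then show ?thesis using triple S bal sum_sq_sides_ge[of a b d c r] by auto
  qed
qed

section \<open>Replacing one point\<close>

text \<open>
  The list \<open>js\<close> holds a position of each point of the support \<open>S\<close>. Changing any other position
  keeps all of \<open>S\<close> in the list, and \<open>S\<close> alone forces the area \<open>\<pi> r\<^sup>2\<close>. The factor is written as a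
  difference of reals to avoid truncated subtraction.
\<close>

lemma sum_enclosing_area_ge:
  fixes xs :: "(real^2) list"
  assumes S: "S \<subseteq> set xs" "balanced_disk S c r"
    and I: "distinct js" "set js \<subseteq> {..<length xs}" "S \<subseteq> (!) xs ` set js"
  shows "(real (length xs) - length js) * (pi * r\<^sup>2) + (\<Sum>i\<leftarrow>js. enclosing_area (xs[i := z]))
         \<le> (\<Sum>i<length xs. enclosing_area (xs[i := z]))"
proof -
  have ge: "pi * r\<^sup>2 \<le> enclosing_area (xs[i := z])" if "i \<in> {..<length xs} - set js" for i
  proof (rule enclosing_area_ge_balanced[OF S(2)])
    show "S \<subseteq> set (xs[i := z])"
    proof
      fix a assume "a \<in> S"
      then obtain j where j: "j \<in> set js" "a = xs ! j" using I(3) by auto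
      then have "i \<noteq> j" "j < length (xs[i := z])" using that I(2) by auto
      then have "a = xs[i := z] ! j" using j(2) by simp
      then show "a \<in> set (xs[i := z])" using \<open>j < length (xs[i := z])\<close> nth_mem by metis
    qed
    show "xs[i := z] \<noteq> []" using that by auto
  qed
  have card: "card ({..<length xs} - set js) = length xs - length js" "length js \<le> length xs"
    using I card_mono[of "{..<length xs}" "set js"] by (auto simp: card_Diff_subset distinct_card)
  have "(\<Sum>i<length xs. enclosing_area (xs[i := z])) =
    (\<Sum>i\<in>{..<length xs} - set js. enclosing_area (xs[i := z])) + (\<Sum>i\<in>set js. enclosing_area (xs[i := z]))"
    using I(2) by (intro sum.subset_diff) auto
  moreover have "(\<Sum>i\<in>{..<length xs} - set js. enclosing_area (xs[i := z])) \<ge>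
      (\<Sum>i\<in>{..<length xs} - set js. pi * r\<^sup>2)"
    by (intro sum_mono ge)
  ultimately show ?thesis using card I(1) by (simp add: sum_list_distinct_conv_sum_set of_nat_diff)
qed

lemma enclosing_area_update_ge_new:
  assumes "i < length xs" "j < length xs" "i \<noteq> j"
  shows "pi * (dist (xs ! j) z)\<^sup>2 / 4 \<le> enclosing_area (xs[i := z])"
proof (rule enclosing_area_ge_pair)
  show "z \<in> set (xs[i := z])" using assms by (simp add: set_update_memI)
  show "xs ! j \<in> set (xs[i := z])" using assms by (metis length_list_update nth_list_update_neq nth_mem)
qed

lemma enclosing_area_update_ge_old:
  assumes "i < length xs" "j < length xs" "k < length xs" "i \<noteq> j" "i \<noteq> k"
  shows "pi * (dist (xs ! j) (xs ! k))\<^sup>2 / 4 \<le> enclosing_area (xs[i := z])"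
  by (rule enclosing_area_ge_pair) (metis assms length_list_update nth_list_update_neq nth_mem)+

lemma dist_sq_pair_ge:
  fixes a b z :: "'a::euclidean_space"
  shows "(dist a b)\<^sup>2 \<le> 2 * ((dist a z)\<^sup>2 + (dist b z)\<^sup>2)"
proof -
  have "(dist a b)\<^sup>2 \<le> (dist a z + dist b z)\<^sup>2"
    by (intro power_mono) (auto simp: dist_triangle2)
  moreover have "0 \<le> (dist a z - dist b z)\<^sup>2" by simp
  ultimately show ?thesis by (simp add: power2_eq_square algebra_simps)
qed

text \<open>
  A pair \<open>a, b\<close> as support is estimated by means of the distances to \<open>z\<close>, since \<open>z\<close> and
  the support point that is left remain in the list. For a triple, two support points are left
  after each replacement, and the sides of the triangle suffice.
\<close>

lemma enclosing_area_simplex_inequality: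
  fixes xs :: "(real^2) list"
  assumes "xs \<noteq> []"
  shows "(real (length xs) - 3 / 2) * enclosing_area xs \<le> (\<Sum>i<length xs. enclosing_area (xs[i := z]))"
proof -
  obtain c r where cr: "balanced_disk (set xs) c r" "enclosing_area xs = pi * r\<^sup>2"
    using enclosing_area_disk[OF assms] .
  have "0 \<le> r" using cr by (simp add: balanced_disk_def)
  show ?thesis
  proof (cases "r = 0")
    case True
    then show ?thesis using cr(2) by (simp add: sum_nonneg enclosing_area_nonneg)
  next
    case False
    with \<open>0 \<le> r\<close> have "0 < r" by simp
    from cr(1) this show ?thesis
    proof (cases rule: balanced_disk_support)
      case (pair a b)
      obtain i j where ij: "i < length xs" "j < length xs" "a = xs ! i" "b = xs ! j"
        using pair(2) by (auto simp: in_set_conv_nth)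
      have "i \<noteq> j" using ij pair(1) by auto
      have "(real (length xs) - 2) * (pi * r\<^sup>2) +
          (enclosing_area (xs[i := z]) + enclosing_area (xs[j := z]))
        \<le> (\<Sum>k<length xs. enclosing_area (xs[k := z]))"
        using sum_enclosing_area_ge[OF pair(2,3), of "[i, j]" z] ij \<open>i \<noteq> j\<close> by auto
      moreover have "pi * (dist b z)\<^sup>2 / 4 \<le> enclosing_area (xs[i := z])"
        "pi * (dist a z)\<^sup>2 / 4 \<le> enclosing_area (xs[j := z])"
        using enclosing_area_update_ge_new[of i xs j z] enclosing_area_update_ge_new[of j xs i z] ij \<open>i \<noteq> j\<close> by auto
      moreover have "pi * (2 * r\<^sup>2) \<le> pi * ((dist a z)\<^sup>2 + (dist b z)\<^sup>2)"
        using dist_sq_pair_ge[of a b z] pair(4) by (simp add: power_mult_distrib)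
      ultimately show ?thesis unfolding cr(2) by (simp add: algebra_simps)
    next
      case (triple a b d)
      obtain i j k where ijk: "i < length xs" "j < length xs" "k < length xs"
        "a = xs ! i" "b = xs ! j" "d = xs ! k"
        using triple(2) by (auto simp: in_set_conv_nth)
      have ne: "i \<noteq> j" "j \<noteq> k" "k \<noteq> i" using ijk triple(1) by auto
      have "(real (length xs) - 3) * (pi * r\<^sup>2) +
          (enclosing_area (xs[i := z]) + enclosing_area (xs[j := z]) + enclosing_area (xs[k := z]))
        \<le> (\<Sum>k<length xs. enclosing_area (xs[k := z]))"
        using sum_enclosing_area_ge[OF triple(2,3), of "[i, j, k]" z] ijk ne by (auto simp: add_ac)
      moreover have "pi * (dist b d)\<^sup>2 / 4 \<le> enclosing_area (xs[i := z])"
        "pi * (dist d a)\<^sup>2 / 4 \<le> enclosing_area (xs[j := z])"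
        "pi * (dist a b)\<^sup>2 / 4 \<le> enclosing_area (xs[k := z])"
        using enclosing_area_update_ge_old[of i xs j k z] enclosing_area_update_ge_old[of j xs k i z]
          enclosing_area_update_ge_old[of k xs i j z] ijk ne by auto
      moreover have "8 * (pi * r\<^sup>2) \<le> pi * (dist a b)\<^sup>2 + pi * (dist b d)\<^sup>2 + pi * (dist d a)\<^sup>2"
        using mult_left_mono[OF triple(4), of pi] by (simp add: distrib_left)
      ultimately have "(real (length xs) - 1) * (pi * r\<^sup>2)
          \<le> (\<Sum>k<length xs. enclosing_area (xs[k := z]))"
        unfolding left_diff_distrib by linarith
      moreover have "(real (length xs) - 3 / 2) * (pi * r\<^sup>2) \<le> (real (length xs) - 1) * (pi * r\<^sup>2)"
        by (intro mult_right_mono) auto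
      ultimately show ?thesis unfolding cr(2) by linarith
    qed
  qed
qed

section \<open>Sharpness\<close>

text \<open>
  The list consists of two antipodal unit vectors and copies of the origin, and \<open>z\<close> is the origin.
  Replacing an antipode halves the radius, so it leaves a quarter of the area, and the other
  replacements change nothing: the sum is at most \<open>\<pi>/4 + \<pi>/4 + (n - 2) \<pi>\<close>.
\<close>

lemma enclosing_area_extremal:
  fixes n :: nat
  assumes "n \<ge> 2"
  obtains xs :: "(real^2) list" and z where "length xs = n" "enclosing_area xs = pi"
    "(\<Sum>i<n. enclosing_area (xs[i := z])) \<le> (real n - 3 / 2) * pi"
proof -
  define e :: "real^2" where "e = axis 1 1"
  have e: "norm e = 1" by (simp add: e_def norm_axis_1)
  define ys where "ys = replicate (n - 2) (0::real^2)"
  define xs where "xs = e # - e # ys"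
  have ys: "set ys \<subseteq> {0}" by (auto simp: ys_def)
  have len: "length xs = n" using assms by (simp add: xs_def ys_def)
  have "midpoint e (- e) = 0" "dist e (- e) / 2 = 1"
    using e by (auto simp: midpoint_def dist_norm scaleR_2[symmetric])
  with balanced_disk_pair[of e "- e"] have bal: "balanced_disk {e, - e} 0 1" by simp
  have "enclosing_area xs \<le> pi * 1\<^sup>2"
    using ys e by (intro enclosing_area_le[where d = 0]) (auto simp: xs_def)
  moreover have "pi * 1\<^sup>2 \<le> enclosing_area xs"
    by (rule enclosing_area_ge_balanced[OF bal]) (auto simp: xs_def)
  ultimately have area: "enclosing_area xs = pi" by simp
  have half: "enclosing_area (xs[i := 0]) \<le> pi / 4" if "i < 2" for i
  proof -
    define u where "u = (if i = 0 then - e else e)"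
    have "set (xs[i := 0]) \<subseteq> {0, u}" using that ys by (auto simp: xs_def u_def less_2_cases_iff)
    moreover have "{0, u} \<subseteq> cball (midpoint 0 u) (1 / 2)"
      using balanced_disk_pair[of 0 u] e by (simp add: balanced_disk_def u_def split: if_splits)
    moreover have "xs[i := 0] \<noteq> []" by (metis list_update_nonempty list.distinct(1) xs_def)
    ultimately have "enclosing_area (xs[i := 0]) \<le> pi * (1 / 2)\<^sup>2"
      by (intro enclosing_area_le[where d = "midpoint 0 u"]) auto
    then show ?thesis by (simp add: power_divide)
  qed
  have rest: "xs[i := 0] = xs" if "i \<in> {2..<n}" for i
  proof -
    define j where "j = i - 2"
    have "i = Suc (Suc j)" "j < n - 2" using that by (auto simp: j_def)
    then show ?thesis by (simp add: xs_def ys_def list_update_same_conv)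
  qed
  have "{..<n} = {0, 1} \<union> {2..<n}" using assms by auto
  then have "(\<Sum>i<n. enclosing_area (xs[i := 0])) =
      enclosing_area (xs[0 := 0]) + enclosing_area (xs[1 := 0]) + (\<Sum>i\<in>{2..<n}. enclosing_area (xs[i := 0]))"
    by (simp add: sum.union_disjoint)
  also have "(\<Sum>i\<in>{2..<n}. enclosing_area (xs[i := 0])) = (real n - 2) * pi"
    using rest area assms by (simp add: of_nat_diff)
  finally have "(\<Sum>i<n. enclosing_area (xs[i := 0])) \<le> (real n - 3 / 2) * pi"
    using half[of 0] half[of 1] by (simp add: algebra_simps)
  with len area show ?thesis by (rule that)
qed

section \<open>The best constant\<close>

theorem proposition4p4:
  fixes n :: nat
  assumes "n \<ge> 3"
  shows "n_distance n (UNIV :: (real^2) set) enclosing_area \<and>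
         best_constant n (UNIV :: (real^2) set) enclosing_area = inverse (real n - 3 / 2)"
proof -
  define k where "k = real n - 3 / 2"
  have k: "1 \<le> k" using assms by (simp add: k_def)
  have main: "k * enclosing_area xs \<le> (\<Sum>i<n. enclosing_area (xs[i := z]))"
    if "xs \<in> tuples n UNIV" for xs and z :: "real^2"
  proof -
    have "length xs = n" "xs \<noteq> []" using that assms by (auto simp: tuples_def)
    then show ?thesis using enclosing_area_simplex_inequality[of xs z] by (simp add: k_def)
  qed
  have "n_distance n (UNIV :: (real^2) set) enclosing_area"
    unfolding n_distance_def
  proof (intro conjI ballI allI impI)
    fix xs :: "(real^2) list" assume xs: "xs \<in> tuples n UNIV"
    show "0 \<le> enclosing_area xs" by (rule enclosing_area_nonneg)
    show "enclosing_area xs \<le> (\<Sum>i<n. enclosing_area (xs[i := z]))" for z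
      using main[OF xs, of z] mult_right_mono[OF k enclosing_area_nonneg[of xs]] by simp
    show "enclosing_area (permute_list p xs) = enclosing_area xs" if "p permutes {..<n}" for p
      using that xs
      by (simp add: enclosing_area_def smallest_enclosing_circle_def set_permute_list tuples_def)
    have "xs \<noteq> []" using xs assms by (auto simp: tuples_def)
    then show "enclosing_area xs = 0 \<longleftrightarrow> (\<forall>i<n. \<forall>j<n. xs ! i = xs ! j)"
      using xs by (simp add: enclosing_area_eq_0_iff tuples_def all_set_conv_all_nth)
  qed simp
  moreover have "best_constant n (UNIV :: (real^2) set) enclosing_area = inverse k"
    unfolding best_constant_def
  proof (rule cInf_eq_minimum)
    show "inverse k \<in> {K. 0 < K \<and> K \<le> 1 \<and> (\<forall>xs \<in> tuples n UNIV. \<forall>z \<in> (UNIV :: (real^2) set).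
        enclosing_area xs \<le> K * (\<Sum>i<n. enclosing_area (xs[i := z])))}"
      using k main by (auto simp: field_simps)
  next
    fix K assume K: "K \<in> {K. 0 < K \<and> K \<le> 1 \<and> (\<forall>xs \<in> tuples n UNIV. \<forall>z \<in> (UNIV :: (real^2) set).
        enclosing_area xs \<le> K * (\<Sum>i<n. enclosing_area (xs[i := z])))}"
    obtain xs :: "(real^2) list" and z where xs: "length xs = n" "enclosing_area xs = pi"
      "(\<Sum>i<n. enclosing_area (xs[i := z])) \<le> k * pi"
      using enclosing_area_extremal[of n] assms unfolding k_def by auto
    have "pi \<le> K * (\<Sum>i<n. enclosing_area (xs[i := z]))" using K xs by (auto simp: tuples_def)
    also have "\<dots> \<le> K * (k * pi)" using K xs(3) by (intro mult_left_mono) auto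
    finally have "1 \<le> K * k" by simp
    then show "inverse k \<le> K" using k by (simp add: field_simps)
  qed
  ultimately show ?thesis by (simp add: k_def)
qed

end
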